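(* Let $G$ be a Lie group, $N\subset G$ a closed normal subgroup, and $(X,\sigma,\Phi)$ a homogeneous hamiltonian $G$-space. Then the composite map $$X\xrightarrow{\ \Phi\ }\mathfrak g^*\xrightarrow{\ (\cdot)_{|\mathfrak n}\ }\mathfrak n^*\xrightarrow{\ N(\cdot)\ }\mathfrak n^*/N$$ maps $X$ onto a $G$-orbit $\mathcal U=G(U)=G/G_U$ in $\mathfrak n^*/N$.
   Context: A hamiltonian $G$-space is a triple $(X,\sigma,\Phi)$ where $(X,\sigma)$ is a symplectic manifold on which $G$ acts smoothly preserving $\sigma$, and $\Phi:X\to\mathfrak g^*$ is a $G$-equivariant (moment) map (for the coadjoint action $\langle g(m),Z\rangle=\langle m,\operatorname{Ad}(g^{-1})Z\rangle$ on $\mathfrak g^*$) such that the infinitesimal action of each $Z\in\mathfrak g$ is the vector field $\operatorname{drag}\langle\Phi(\cdot),Z\rangle$, where $\sigma(\operatorname{drag}f,\cdot)=-df$. It is homogeneous if $G$ acts transitively on $X$. $\mathfrak n$ is the Lie algebra of $N$; $\mathfrak n^*/N$ is the set of $N$-coadjoint orbits in $\mathfrak n^*$. Since $N$ is normal, $G$ acts naturally on $\mathfrak n$ and $\mathfrak n^*$, respecting the partition of $\mathfrak n^*$ into $N$-orbits, hence acts on $\mathfrak n^*/N$. The first map is the moment map, the second is restriction to $\mathfrak n$, and the third sends a point to its $N$-orbit. For $U\in\mathfrak n^*/N$, $G_U$ denotes its stabilizer in $G$. *)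

theory Defs
  imports
    "HOL-Analysis.Analysis"
    "HOL-Algebra.Group_Action"
    "HOL-Algebra.Left_Coset"
begin

section \<open>Model spaces and smooth maps between them\<close>

text \<open>Finite-dimensional real inner product spaces: the assumption says that \<open>x \<mapsto> (\<langle>x, b\<rangle>)\<^sub>b\<close>
  is injective into \<open>\<real>\<^sup>B\<close> for some finite \<open>B\<close>. Unlike \<^class>\<open>euclidean_space\<close>, this class
  allows dimension zero, which is needed: discrete groups are Lie groups, and a point is a
  homogeneous symplectic manifold.\<close>

class fin_dim_inner = real_inner +
  assumes finite_separating_set: "\<exists>B. finite B \<and> (\<forall>x. (\<forall>b\<in>B. inner x b = 0) \<longrightarrow> x = 0)"

lemma fin_dim_inner_span: "\<exists>B. finite B \<and> span B = (UNIV :: 'a::fin_dim_inner set)"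
proof -
  obtain B :: "'a set" where B: "finite B" "\<And>x. (\<And>b. b \<in> B \<Longrightarrow> inner x b = 0) \<Longrightarrow> x = 0"
    using finite_separating_set by blast
  obtain C where C: "finite C" "span C = span B" "pairwise orthogonal C"
    using basis_orthogonal[OF B(1)] by blast
  have "x \<in> span B" for x
  proof -
    define y where "y = x - (\<Sum>c\<in>C. (c \<bullet> x / (c \<bullet> c)) *\<^sub>R c)"
    have y: "inner c y = 0" if "c \<in> C" for c
    proof -
      have "(\<Sum>d\<in>C. (inner d x / inner d d) * inner c d) =
            (\<Sum>d\<in>C. if d = c then inner c x else 0)"
        using C(3) that by (intro sum.cong) (auto simp: pairwise_def orthogonal_def)
      then show ?thesis
        using C(1) that by (simp add: y_def inner_diff_right inner_sum_right)
    qed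
    have "orthogonal y b" if "b \<in> span C" for b
      by (rule orthogonal_to_span[OF that]) (simp add: orthogonal_def inner_commute y)
    then have "inner b y = 0" if "b \<in> B" for b
      using C(2) span_base[OF that] by (simp add: orthogonal_def inner_commute)
    then have "inner y b = 0" if "b \<in> B" for b
      using that by (simp add: inner_commute)
    then have "y = 0" by (rule B(2))
    moreover have "(\<Sum>c\<in>C. (c \<bullet> x / (c \<bullet> c)) *\<^sub>R c) \<in> span C"
      by (intro span_sum span_scale span_base)
    ultimately show ?thesis using C(2) by (simp add: y_def)
  qed
  then show ?thesis using B(1) by blast
qed

subclass (in euclidean_space) fin_dim_inner
  by standard (use finite_Basis euclidean_all_zero_iff in blast)

instance prod :: (fin_dim_inner, fin_dim_inner) fin_dim_inner
proof
  obtain B :: "'a set" where B: "finite B" "\<And>x. \<forall>b\<in>B. inner x b = 0 \<Longrightarrow> x = 0"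
    using finite_separating_set by blast
  obtain C :: "'b set" where C: "finite C" "\<And>x. \<forall>b\<in>C. inner x b = 0 \<Longrightarrow> x = 0"
    using finite_separating_set by blast
  let ?D = "(\<lambda>b. (b, 0::'b)) ` B \<union> (\<lambda>c. (0::'a, c)) ` C"
  have "p = 0" if "\<forall>d\<in>?D. inner p d = 0" for p
  proof -
    have "inner (fst p) b = 0" if "b \<in> B" for b
      using bspec[OF \<open>\<forall>d\<in>?D. inner p d = 0\<close>, of "(b, 0)"] that by (simp add: inner_prod_def)
    moreover have "inner (snd p) c = 0" if "c \<in> C" for c
      using bspec[OF \<open>\<forall>d\<in>?D. inner p d = 0\<close>, of "(0, c)"] that by (simp add: inner_prod_def)
    ultimately show ?thesis using B(2) C(2) by (simp add: prod_eq_iff)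
  qed
  then show "\<exists>D. finite D \<and> (\<forall>x :: 'a \<times> 'b. (\<forall>d\<in>D. inner x d = 0) \<longrightarrow> x = 0)"
    using B(1) C(1) by (intro exI[of _ ?D]) auto
qed

text \<open>\<open>C\<^sup>k\<close> regularity on an open set \<open>V\<close>, by recursion through directional derivatives; between
  finite-dimensional spaces this is the usual notion.\<close>

primrec k_smooth_on ::
  "nat \<Rightarrow> 'a::real_normed_vector set \<Rightarrow> ('a \<Rightarrow> 'b::real_normed_vector) \<Rightarrow> bool" where
  "k_smooth_on 0 V f \<longleftrightarrow> continuous_on V f"
| "k_smooth_on (Suc k) V f \<longleftrightarrow>
     (\<forall>x\<in>V. f differentiable (at x)) \<and>
     (\<forall>v. k_smooth_on k V (\<lambda>x. frechet_derivative f (at x) v))"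

definition smooth_on ::
  "'a::real_normed_vector set \<Rightarrow> ('a \<Rightarrow> 'b::real_normed_vector) \<Rightarrow> bool" where
  "smooth_on V f \<longleftrightarrow> (\<forall>k. k_smooth_on k V f)"


section \<open>Smooth manifolds\<close>

type_synonym ('a, 'e) chart = "'a set \<times> ('a \<Rightarrow> 'e)"

record ('a, 'e) manifold =
  mtop :: "'a topology"
  atlas :: "('a, 'e) chart set"

abbreviation points :: "('a, 'e, 'z) manifold_scheme \<Rightarrow> 'a set" where
  "points M \<equiv> topspace (mtop M)"

definition smooth_manifold :: "('a, 'e::fin_dim_inner) manifold \<Rightarrow> bool" where
  "smooth_manifold M \<longleftrightarrow>
     Hausdorff_space (mtop M) \<and> second_countable (mtop M) \<and>
     (\<forall>(U, \<phi>) \<in> atlas M. openin (mtop M) U \<and> open (\<phi> ` U) \<and>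
        homeomorphic_map (subtopology (mtop M) U) (top_of_set (\<phi> ` U)) \<phi>) \<and>
     (\<Union>(U, \<phi>) \<in> atlas M. U) = points M \<and>
     (\<forall>(U, \<phi>) \<in> atlas M. \<forall>(V, \<psi>) \<in> atlas M.
        smooth_on (\<phi> ` (U \<inter> V)) (\<psi> \<circ> inv_into U \<phi>))"

definition smooth_map ::
  "('a, 'e::fin_dim_inner) manifold \<Rightarrow> ('b, 'f::fin_dim_inner) manifold \<Rightarrow> ('a \<Rightarrow> 'b) \<Rightarrow> bool"
where
  "smooth_map M M' F \<longleftrightarrow>
     continuous_map (mtop M) (mtop M') F \<and>
     (\<forall>(U, \<phi>) \<in> atlas M. \<forall>(V, \<psi>) \<in> atlas M'.
        smooth_on (\<phi> ` (U \<inter> F -` V)) (\<psi> \<circ> F \<circ> inv_into U \<phi>))"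

definition product_manifold ::
  "('a, 'e::fin_dim_inner) manifold \<Rightarrow> ('b, 'f::fin_dim_inner) manifold \<Rightarrow>
   ('a \<times> 'b, 'e \<times> 'f) manifold" where
  "product_manifold M M' =
     \<lparr>mtop = prod_topology (mtop M) (mtop M'),
      atlas = {(U \<times> V, map_prod \<phi> \<psi>) | U \<phi> V \<psi>. (U, \<phi>) \<in> atlas M \<and> (V, \<psi>) \<in> atlas M'}\<rparr>"

definition real_line :: "(real, real) manifold" where
  "real_line = \<lparr>mtop = euclideanreal, atlas = {(UNIV, id)}\<rparr>"

text \<open>Functions on a manifold are taken \<^const>\<open>extensional\<close>, so that they are determined by their
  values at its points. The same convention is used below for tangent vectors, linear forms
  and actions.\<close>

definition smooth_functions :: "('a, 'e::fin_dim_inner) manifold \<Rightarrow> ('a \<Rightarrow> real) set" where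
  "smooth_functions M =
     {f \<in> extensional (points M). \<forall>(U, \<phi>) \<in> atlas M. smooth_on (\<phi> ` U) (f \<circ> inv_into U \<phi>)}"


section \<open>Tangent vectors\<close>

text \<open>Tangent vectors are point derivations of the algebra of smooth functions.\<close>

type_synonym 'a tvec = "('a \<Rightarrow> real) \<Rightarrow> real"

definition tangent_space :: "('a, 'e::fin_dim_inner) manifold \<Rightarrow> 'a \<Rightarrow> 'a tvec set" where
  "tangent_space M p =
     {v \<in> extensional (smooth_functions M).
        (\<forall>f \<in> smooth_functions M. \<forall>g \<in> smooth_functions M. \<forall>a b.
           v (\<lambda>x\<in>points M. a * f x + b * g x) = a * v f + b * v g) \<and>
        (\<forall>f \<in> smooth_functions M. \<forall>g \<in> smooth_functions M.
           v (\<lambda>x\<in>points M. f x * g x) = f p * v g + g p * v f)}"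

text \<open>The linear combination \<open>a u + b v\<close> of tangent vectors.\<close>

definition lincomb ::
  "('a, 'e::fin_dim_inner) manifold \<Rightarrow> real \<Rightarrow> 'a tvec \<Rightarrow> real \<Rightarrow> 'a tvec \<Rightarrow> 'a tvec" where
  "lincomb M a u b v = (\<lambda>f\<in>smooth_functions M. a * u f + b * v f)"

definition zero_vec :: "('a, 'e::fin_dim_inner) manifold \<Rightarrow> 'a tvec" where
  "zero_vec M = (\<lambda>f\<in>smooth_functions M. 0)"

text \<open>The tangent map of \<open>F : M \<rightarrow> M'\<close>.\<close>

definition tangent_map ::
  "('a, 'e::fin_dim_inner) manifold \<Rightarrow> ('b, 'f::fin_dim_inner) manifold \<Rightarrow> ('a \<Rightarrow> 'b) \<Rightarrow>
   'a tvec \<Rightarrow> 'b tvec" where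
  "tangent_map M M' F v = (\<lambda>h\<in>smooth_functions M'. v (\<lambda>x\<in>points M. h (F x)))"

definition velocity :: "('a, 'e::fin_dim_inner) manifold \<Rightarrow> (real \<Rightarrow> 'a) \<Rightarrow> real \<Rightarrow> 'a tvec" where
  "velocity M c t = (\<lambda>f\<in>smooth_functions M. deriv (\<lambda>s. f (c s)) t)"

text \<open>The constant coordinate vector field \<open>\<partial>\<^sub>e\<close> of a chart, in the direction \<open>e\<close> of the model
  space.\<close>

fun coordinate_vector ::
  "('a, 'e::fin_dim_inner) manifold \<Rightarrow> ('a, 'e) chart \<Rightarrow> 'e \<Rightarrow> 'a \<Rightarrow> 'a tvec" where
  "coordinate_vector M (U, \<phi>) e p =
     (\<lambda>f\<in>smooth_functions M. frechet_derivative (f \<circ> inv_into U \<phi>) (at (\<phi> p)) e)"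


section \<open>Symplectic manifolds\<close>

type_synonym 'a two_form = "'a \<Rightarrow> 'a tvec \<Rightarrow> 'a tvec \<Rightarrow> real"

text \<open>The coefficient \<open>\<sigma>(\<partial>\<^sub>e, \<partial>\<^sub>e\<^sub>')\<close> of a 2-form, as a function of the coordinates.\<close>

fun form_coeff ::
  "('a, 'e::fin_dim_inner) manifold \<Rightarrow> 'a two_form \<Rightarrow> ('a, 'e) chart \<Rightarrow> 'e \<Rightarrow> 'e \<Rightarrow> 'e \<Rightarrow> real" where
  "form_coeff M \<sigma> (U, \<phi>) e e' y =
     \<sigma> (inv_into U \<phi> y)
       (coordinate_vector M (U, \<phi>) e (inv_into U \<phi> y))
       (coordinate_vector M (U, \<phi>) e' (inv_into U \<phi> y))"

definition smooth_two_form :: "('a, 'e::fin_dim_inner) manifold \<Rightarrow> 'a two_form \<Rightarrow> bool" where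
  "smooth_two_form M \<sigma> \<longleftrightarrow>
     (\<forall>x \<in> points M. \<forall>u \<in> tangent_space M x. \<forall>v \<in> tangent_space M x. \<forall>w \<in> tangent_space M x.
        \<forall>a b. \<sigma> x (lincomb M a u b v) w = a * \<sigma> x u w + b * \<sigma> x v w) \<and>
     (\<forall>x \<in> points M. \<forall>v \<in> tangent_space M x. \<forall>w \<in> tangent_space M x. \<sigma> x v w = - \<sigma> x w v) \<and>
     (\<forall>(U, \<phi>) \<in> atlas M. \<forall>e e'. smooth_on (\<phi> ` U) (form_coeff M \<sigma> (U, \<phi>) e e'))"

text \<open>\<open>d\<sigma> = 0\<close>, where \<open>(d\<sigma>)(\<partial>\<^sub>a, \<partial>\<^sub>b, \<partial>\<^sub>c) = \<partial>\<^sub>a \<sigma>(\<partial>\<^sub>b, \<partial>\<^sub>c) + \<partial>\<^sub>b \<sigma>(\<partial>\<^sub>c, \<partial>\<^sub>a) + \<partial>\<^sub>c \<sigma>(\<partial>\<^sub>a, \<partial>\<^sub>b)\<close>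
  because coordinate vector fields commute.\<close>

definition closed_two_form :: "('a, 'e::fin_dim_inner) manifold \<Rightarrow> 'a two_form \<Rightarrow> bool" where
  "closed_two_form M \<sigma> \<longleftrightarrow>
     (\<forall>(U, \<phi>) \<in> atlas M. \<forall>y \<in> \<phi> ` U. \<forall>a b c.
        frechet_derivative (form_coeff M \<sigma> (U, \<phi>) b c) (at y) a +
        frechet_derivative (form_coeff M \<sigma> (U, \<phi>) c a) (at y) b +
        frechet_derivative (form_coeff M \<sigma> (U, \<phi>) a b) (at y) c = 0)"

definition nondegenerate :: "('a, 'e::fin_dim_inner) manifold \<Rightarrow> 'a two_form \<Rightarrow> bool" where
  "nondegenerate M \<sigma> \<longleftrightarrow>
     (\<forall>x \<in> points M. \<forall>v \<in> tangent_space M x.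
        (\<forall>w \<in> tangent_space M x. \<sigma> x v w = 0) \<longrightarrow> v = zero_vec M)"

definition symplectic_manifold :: "('a, 'e::fin_dim_inner) manifold \<Rightarrow> 'a two_form \<Rightarrow> bool" where
  "symplectic_manifold M \<sigma> \<longleftrightarrow>
     smooth_manifold M \<and> smooth_two_form M \<sigma> \<and> closed_two_form M \<sigma> \<and> nondegenerate M \<sigma>"

text \<open>The vector field \<open>drag f\<close> with \<open>\<sigma>(drag f, \<cdot>) = - df\<close>; note that \<open>df(w) = w f\<close> for a
  derivation \<open>w\<close>.\<close>

definition drag ::
  "('a, 'e::fin_dim_inner) manifold \<Rightarrow> 'a two_form \<Rightarrow> ('a \<Rightarrow> real) \<Rightarrow> 'a \<Rightarrow> 'a tvec" where
  "drag M \<sigma> f x =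
     (THE v. v \<in> tangent_space M x \<and> (\<forall>w \<in> tangent_space M x. \<sigma> x v w = - w f))"


section \<open>Lie groups, their Lie algebras, and the coadjoint action\<close>

definition lie_group :: "'g monoid \<Rightarrow> ('g, 'e::fin_dim_inner) manifold \<Rightarrow> bool" where
  "lie_group G M \<longleftrightarrow>
     group G \<and> smooth_manifold M \<and> points M = carrier G \<and>
     smooth_map (product_manifold M M) M (\<lambda>(g, h). g \<otimes>\<^bsub>G\<^esub> h) \<and>
     smooth_map M M (\<lambda>g. inv\<^bsub>G\<^esub> g)"

definition lie_algebra :: "'g monoid \<Rightarrow> ('g, 'e::fin_dim_inner) manifold \<Rightarrow> 'g tvec set" where
  "lie_algebra G M = tangent_space M \<one>\<^bsub>G\<^esub>"

definition one_parameter_subgroup ::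
  "'g monoid \<Rightarrow> ('g, 'e::fin_dim_inner) manifold \<Rightarrow> (real \<Rightarrow> 'g) \<Rightarrow> bool" where
  "one_parameter_subgroup G M c \<longleftrightarrow>
     smooth_map real_line M c \<and> (\<forall>s t. c (s + t) = c s \<otimes>\<^bsub>G\<^esub> c t)"

text \<open>The Lie algebra of a closed subgroup \<open>N\<close>, as a subspace of that of \<open>G\<close>: the set of \<open>Z\<close>
  such that \<open>exp(tZ) \<in> N\<close> for all \<open>t\<close>, where \<open>t \<mapsto> exp(tZ)\<close> is the one-parameter subgroup with
  initial velocity \<open>Z\<close>.\<close>

definition subgroup_lie_algebra ::
  "'g monoid \<Rightarrow> ('g, 'e::fin_dim_inner) manifold \<Rightarrow> 'g set \<Rightarrow> 'g tvec set" where
  "subgroup_lie_algebra G M N =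
     {velocity M c 0 | c. one_parameter_subgroup G M c \<and> (\<forall>t. c t \<in> N)}"

definition Ad ::
  "'g monoid \<Rightarrow> ('g, 'e::fin_dim_inner) manifold \<Rightarrow> 'g \<Rightarrow> 'g tvec \<Rightarrow> 'g tvec" where
  "Ad G M g = tangent_map M M (\<lambda>h. g \<otimes>\<^bsub>G\<^esub> h \<otimes>\<^bsub>G\<^esub> inv\<^bsub>G\<^esub> g)"

text \<open>Linear forms on a linear subspace \<open>V\<close> of a tangent space. Membership of \<open>w = a u + b v\<close>
  in \<open>V\<close> is automatic, since \<open>V\<close> will be a Lie algebra.\<close>

definition dual_space ::
  "('a, 'e::fin_dim_inner) manifold \<Rightarrow> 'a tvec set \<Rightarrow> ('a tvec \<Rightarrow> real) set" where
  "dual_space M V =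
     {m \<in> extensional V.
        \<forall>u \<in> V. \<forall>v \<in> V. \<forall>w \<in> V. \<forall>a b.
          w = lincomb M a u b v \<longrightarrow> m w = a * m u + b * m v}"

text \<open>The contragredient of the adjoint action on an invariant subspace \<open>V\<close> of the Lie algebra:
  \<open>\<langle>g(m), Z\<rangle> = \<langle>m, Ad(g\<^sup>-\<^sup>1) Z\<rangle>\<close> for \<open>m \<in> V\<^sup>*\<close>, \<open>Z \<in> V\<close>.\<close>

definition coad ::
  "'g monoid \<Rightarrow> ('g, 'e::fin_dim_inner) manifold \<Rightarrow> 'g tvec set \<Rightarrow>
   'g \<Rightarrow> ('g tvec \<Rightarrow> real) \<Rightarrow> ('g tvec \<Rightarrow> real)" where
  "coad G M V g = (\<lambda>m\<in>dual_space M V. \<lambda>Z\<in>V. m (Ad G M (inv\<^bsub>G\<^esub> g) Z))"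


section \<open>Homogeneous hamiltonian spaces\<close>

definition smooth_action ::
  "'g monoid \<Rightarrow> ('g, 'e::fin_dim_inner) manifold \<Rightarrow> ('x, 'f::fin_dim_inner) manifold \<Rightarrow>
   ('g \<Rightarrow> 'x \<Rightarrow> 'x) \<Rightarrow> bool" where
  "smooth_action G M X act \<longleftrightarrow>
     group_action G (points X) act \<and>
     smooth_map (product_manifold M X) X (\<lambda>(g, x). act g x)"

text \<open>The infinitesimal action \<open>Z(x) = d/dt exp(tZ)(x)\<close> at \<open>t = 0\<close>, that is, the image of \<open>Z\<close> under
  the tangent map at the identity of \<open>g \<mapsto> g(x)\<close>.\<close>

definition infinitesimal_action ::
  "('g, 'e::fin_dim_inner) manifold \<Rightarrow> ('x, 'f::fin_dim_inner) manifold \<Rightarrow>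
   ('g \<Rightarrow> 'x \<Rightarrow> 'x) \<Rightarrow> 'g tvec \<Rightarrow> 'x \<Rightarrow> 'x tvec" where
  "infinitesimal_action M X act Z x = tangent_map M X (\<lambda>g. act g x) Z"

definition hamiltonian_space ::
  "'g monoid \<Rightarrow> ('g, 'e::fin_dim_inner) manifold \<Rightarrow> ('x, 'f::fin_dim_inner) manifold \<Rightarrow>
   ('g \<Rightarrow> 'x \<Rightarrow> 'x) \<Rightarrow> 'x two_form \<Rightarrow> ('x \<Rightarrow> 'g tvec \<Rightarrow> real) \<Rightarrow> bool" where
  "hamiltonian_space G M X act \<sigma> \<Phi> \<longleftrightarrow>
     symplectic_manifold X \<sigma> \<and>
     smooth_action G M X act \<and>
     (\<forall>g \<in> carrier G. \<forall>x \<in> points X. \<forall>v \<in> tangent_space X x. \<forall>w \<in> tangent_space X x.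
        \<sigma> (act g x) (tangent_map X X (act g) v) (tangent_map X X (act g) w) = \<sigma> x v w) \<and>
     (\<forall>x \<in> points X. \<Phi> x \<in> dual_space M (lie_algebra G M)) \<and>
     (\<forall>Z \<in> lie_algebra G M. (\<lambda>x\<in>points X. \<Phi> x Z) \<in> smooth_functions X) \<and>
     (\<forall>g \<in> carrier G. \<forall>x \<in> points X. \<Phi> (act g x) = coad G M (lie_algebra G M) g (\<Phi> x)) \<and>
     (\<forall>Z \<in> lie_algebra G M. \<forall>x \<in> points X.
        infinitesimal_action M X act Z x = drag X \<sigma> (\<lambda>y\<in>points X. \<Phi> y Z) x)"

text \<open>A homogeneous space is nonempty; \<^const>\<open>transitive_action\<close> alone also allows the empty
  set.\<close>

definition homogeneous_hamiltonian_space ::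
  "'g monoid \<Rightarrow> ('g, 'e::fin_dim_inner) manifold \<Rightarrow> ('x, 'f::fin_dim_inner) manifold \<Rightarrow>
   ('g \<Rightarrow> 'x \<Rightarrow> 'x) \<Rightarrow> 'x two_form \<Rightarrow> ('x \<Rightarrow> 'g tvec \<Rightarrow> real) \<Rightarrow> bool" where
  "homogeneous_hamiltonian_space G M X act \<sigma> \<Phi> \<longleftrightarrow>
     hamiltonian_space G M X act \<sigma> \<Phi> \<and>
     transitive_action G (points X) act \<and> points X \<noteq> {}"


section \<open>The space of coadjoint orbits of a normal subgroup\<close>

text \<open>The action of \<open>n \<in> N\<close> on the dual of its Lie algebra is the restriction to \<open>N\<close> of that
  of \<open>G\<close>, since the adjoint action of \<open>N\<close> is the restriction of that of \<open>G\<close>.\<close>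

abbreviation sub_dual ::
  "'g monoid \<Rightarrow> ('g, 'e::fin_dim_inner) manifold \<Rightarrow> 'g set \<Rightarrow> ('g tvec \<Rightarrow> real) set" where
  "sub_dual G M N \<equiv> dual_space M (subgroup_lie_algebra G M N)"

abbreviation sub_coad ::
  "'g monoid \<Rightarrow> ('g, 'e::fin_dim_inner) manifold \<Rightarrow> 'g set \<Rightarrow>
   'g \<Rightarrow> ('g tvec \<Rightarrow> real) \<Rightarrow> ('g tvec \<Rightarrow> real)" where
  "sub_coad G M N \<equiv> coad G M (subgroup_lie_algebra G M N)"

definition N_orbit ::
  "'g monoid \<Rightarrow> ('g, 'e::fin_dim_inner) manifold \<Rightarrow> 'g set \<Rightarrow>
   ('g tvec \<Rightarrow> real) \<Rightarrow> ('g tvec \<Rightarrow> real) set" where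
  "N_orbit G M N m = orbit (G\<lparr>carrier := N\<rparr>) (sub_coad G M N) m"

definition orbit_space ::
  "'g monoid \<Rightarrow> ('g, 'e::fin_dim_inner) manifold \<Rightarrow> 'g set \<Rightarrow> ('g tvec \<Rightarrow> real) set set" where
  "orbit_space G M N = orbits (G\<lparr>carrier := N\<rparr>) (sub_dual G M N) (sub_coad G M N)"

definition orbit_space_action ::
  "'g monoid \<Rightarrow> ('g, 'e::fin_dim_inner) manifold \<Rightarrow> 'g set \<Rightarrow>
   'g \<Rightarrow> ('g tvec \<Rightarrow> real) set \<Rightarrow> ('g tvec \<Rightarrow> real) set" where
  "orbit_space_action G M N g = (\<lambda>U\<in>orbit_space G M N. sub_coad G M N g ` U)"

definition restrict_form ::
  "'g monoid \<Rightarrow> ('g, 'e::fin_dim_inner) manifold \<Rightarrow> 'g set \<Rightarrow>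
   ('g tvec \<Rightarrow> real) \<Rightarrow> ('g tvec \<Rightarrow> real)" where
  "restrict_form G M N m = restrict m (subgroup_lie_algebra G M N)"

end

theory Submission
  imports Defs
begin

text \<open>The composite map \<open>F : X \<rightarrow> \<nn>\<^sup>*/N\<close> is \<open>G\<close>-equivariant, and \<open>X\<close> is a single
  \<open>G\<close>-orbit, so its image is the single \<open>G\<close>-orbit of \<open>U = F(x)\<close> for any point \<open>x\<close> of \<open>X\<close>; the
  orbit-stabilizer bijection then identifies this orbit with \<open>G/G\<^sub>U\<close>. Equivariance splits along
  the three arrows. The moment map is equivariant by hypothesis. Restriction to \<open>\<nn>\<close> is
  equivariant (\<open>restrict_form_coad\<close>) because \<open>\<nn>\<close> is stable under \<open>Ad(G)\<close>. Passing to \<open>N\<close>-orbits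
  is equivariant (\<open>image_normal_orbit\<close>) because \<open>g(N(m)) = (gNg\<^sup>-\<^sup>1)(g(m)) = N(g(m))\<close>; the same
  identity makes \<open>G\<close> act on the orbit space (\<open>action_on_normal_orbits\<close>).

  The analytic content is that \<open>\<nn>\<close>, the set of initial velocities of one-parameter subgroups
  inside \<open>N\<close>, is contained in the Lie algebra of \<open>G\<close> (\<open>velocity_in_tangent_space\<close>) and stable
  under \<open>Ad(G)\<close> (\<open>Ad_subgroup_lie_algebra\<close>). For the latter, \<open>Ad(g)\<close> carries the velocity of \<open>c\<close> to
  the velocity of \<open>t \<mapsto> g c(t) g\<^sup>-\<^sup>1\<close>, which is again a one-parameter subgroup inside the normal
  subgroup \<open>N\<close>. Its smoothness, and the functoriality of tangent maps, rest on the chain rule for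
  smooth maps between manifolds (\<open>smooth_map_compose\<close>, \<open>smooth_functions_pullback\<close>), which comes
  from closure properties of the directional-derivative recursion that defines \<open>C\<^sup>k\<close> maps.\<close>

section \<open>Calculus of smooth maps between model spaces\<close>

lemma frechet_derivative_eqI: "(f has_derivative f') (at x) \<Longrightarrow> frechet_derivative f (at x) = f'"
  by (rule frechet_derivative_at[symmetric])

lemma k_smooth_on_has_derivative:
  "k_smooth_on (Suc k) S f \<Longrightarrow> x \<in> S \<Longrightarrow>
     (f has_derivative frechet_derivative f (at x)) (at x)"
  by (simp add: frechet_derivative_works)

lemma k_smooth_on_frechet_derivative:
  "k_smooth_on (Suc k) S f \<Longrightarrow> k_smooth_on k S (\<lambda>x. frechet_derivative f (at x) v)"
  by simp

lemma k_smooth_on_subset: "k_smooth_on k T f \<Longrightarrow> S \<subseteq> T \<Longrightarrow> k_smooth_on k S f"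
  by (induction k arbitrary: f) (auto intro: continuous_on_subset)

lemma k_smooth_on_SucD: "k_smooth_on (Suc k) S f \<Longrightarrow> k_smooth_on k S f"
proof (induction k arbitrary: f)
  case 0
  then show ?case
    by (auto intro!: continuous_at_imp_continuous_on differentiable_imp_continuous_within)
next
  case (Suc k)
  from Suc.prems have "\<forall>x\<in>S. f differentiable (at x)"
    and "\<And>v. k_smooth_on (Suc k) S (\<lambda>x. frechet_derivative f (at x) v)"
    by simp_all
  with Suc.IH show ?case by simp
qed

text \<open>Openness of \<open>S\<close> matters: derivatives are taken at the points of \<open>S\<close> in the ambient space,
  hence depend on values outside any set that is not open.\<close>

lemma k_smooth_on_cong:
  assumes "open S" and "k_smooth_on k S f" and "\<And>x. x \<in> S \<Longrightarrow> g x = f x"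
  shows "k_smooth_on k S g"
  using assms(2,3)
proof (induction k arbitrary: f g)
  case 0
  then show ?case using continuous_on_cong[of S S g f] by simp
next
  case (Suc k)
  have der: "(g has_derivative frechet_derivative f (at x)) (at x)" if "x \<in> S" for x
    by (rule has_derivative_transform_within_open[OF
          k_smooth_on_has_derivative[OF Suc.prems(1) that] assms(1) that])
       (simp add: Suc.prems(2))
  have "k_smooth_on k S (\<lambda>x. frechet_derivative g (at x) v)" for v
    by (rule Suc.IH[OF k_smooth_on_frechet_derivative[OF Suc.prems(1)]])
       (simp add: frechet_derivative_eqI[OF der])
  then show ?case using der by (auto simp: differentiable_def)
qed

text \<open>The induction step of all closure properties below: it suffices to exhibit some formula for
  the derivative that is \<open>C\<^sup>k\<close>.\<close>

lemma k_smooth_on_SucI: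
  assumes "open S"
    and der: "\<And>x. x \<in> S \<Longrightarrow> (f has_derivative f' x) (at x)"
    and smooth: "\<And>v. k_smooth_on k S (\<lambda>x. f' x v)"
  shows "k_smooth_on (Suc k) S f"
proof -
  have "k_smooth_on k S (\<lambda>x. frechet_derivative f (at x) v)" for v
    by (rule k_smooth_on_cong[OF assms(1) smooth]) (simp add: frechet_derivative_eqI[OF der])
  then show ?thesis using der by (auto simp: differentiable_def)
qed

lemma k_smooth_on_local:
  assumes "\<And>x. x \<in> S \<Longrightarrow> \<exists>W. x \<in> W \<and> open W \<and> k_smooth_on k W f"
  shows "k_smooth_on k S f"
  using assms
proof (induction k arbitrary: f)
  case 0
  show ?case unfolding k_smooth_on.simps
  proof (rule continuous_at_imp_continuous_on, rule ballI)
    fix x assume "x \<in> S"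
    then obtain W where "x \<in> W" "open W" "continuous_on W f" using 0 by force
    then show "continuous (at x) f" by (simp add: continuous_on_eq_continuous_at)
  qed
next
  case (Suc k)
  have "f differentiable (at x)" if "x \<in> S" for x
    using Suc.prems[OF that] k_smooth_on_has_derivative unfolding differentiable_def by blast
  moreover have "k_smooth_on k S (\<lambda>x. frechet_derivative f (at x) v)" for v
  proof (rule Suc.IH)
    fix x assume "x \<in> S"
    then obtain W where "x \<in> W" "open W" "k_smooth_on (Suc k) W f" using Suc.prems by blast
    then show "\<exists>W. x \<in> W \<and> open W \<and> k_smooth_on k W (\<lambda>x. frechet_derivative f (at x) v)"
      using k_smooth_on_frechet_derivative by (intro exI conjI)
  qed
  ultimately show ?case by simp
qed

lemma k_smooth_on_const: "k_smooth_on k S (\<lambda>x. c)"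
  by (induction k arbitrary: c) auto

lemma k_smooth_on_add:
  assumes "open S" "k_smooth_on k S f" "k_smooth_on k S g"
  shows "k_smooth_on k S (\<lambda>x. f x + g x)"
  using assms(2,3)
proof (induction k arbitrary: f g)
  case (Suc k)
  show ?case
    by (rule k_smooth_on_SucI[OF assms(1)
          has_derivative_add[OF Suc.prems[THEN k_smooth_on_has_derivative]]
          Suc.IH[OF Suc.prems[THEN k_smooth_on_frechet_derivative]]])
qed (simp add: continuous_on_add)

lemma k_smooth_on_sum:
  assumes "open S" "\<And>i. i \<in> I \<Longrightarrow> k_smooth_on k S (f i)"
  shows "k_smooth_on k S (\<lambda>x. \<Sum>i\<in>I. f i x)"
  using assms(2)
proof (induction I rule: infinite_finite_induct)
  case (insert i I)
  then show ?case using k_smooth_on_add[OF assms(1), of k "f i"] by simp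
qed (simp_all add: k_smooth_on_const)

lemma k_smooth_on_bounded_linear:
  assumes "open S" "bounded_linear L" "k_smooth_on k S f"
  shows "k_smooth_on k S (\<lambda>x. L (f x))"
  using assms(3)
proof (induction k arbitrary: f)
  case 0
  then show ?case by (simp add: bounded_linear.continuous_on[OF assms(2)])
next
  case (Suc k)
  show ?case
    by (rule k_smooth_on_SucI[OF assms(1)
          bounded_linear.has_derivative[OF assms(2) k_smooth_on_has_derivative[OF Suc.prems]]
          Suc.IH[OF k_smooth_on_frechet_derivative[OF Suc.prems]]])
qed

lemma k_smooth_on_scaleR:
  assumes "open S" "k_smooth_on k S a" "k_smooth_on k S f"
  shows "k_smooth_on k S (\<lambda>x. a x *\<^sub>R f x)"
  using assms(2,3)
proof (induction k arbitrary: a f)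
  case (Suc k)
  show ?case
    by (rule k_smooth_on_SucI[OF assms(1)
          has_derivative_scaleR[OF Suc.prems[THEN k_smooth_on_has_derivative]]
          k_smooth_on_add[OF assms(1)
            Suc.IH[OF k_smooth_on_SucD[OF Suc.prems(1)] k_smooth_on_frechet_derivative[OF Suc.prems(2)]]
            Suc.IH[OF k_smooth_on_frechet_derivative[OF Suc.prems(1)] k_smooth_on_SucD[OF Suc.prems(2)]]]])
qed (simp add: continuous_on_scaleR)

text \<open>Expansion in an orthogonal spanning set. It may contain the zero vector, whose term vanishes
  since division by zero gives zero.\<close>

lemma fin_dim_inner_expansion:
  "\<exists>C. finite C \<and> (\<forall>x :: 'a::fin_dim_inner. x = (\<Sum>c\<in>C. (inner c x / inner c c) *\<^sub>R c))"
proof -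
  obtain B :: "'a set" where B: "finite B" "span B = UNIV"
    using fin_dim_inner_span by blast
  obtain C where C: "finite C" "span C = span B" "pairwise orthogonal C"
    using basis_orthogonal[OF B(1)] by blast
  have "x = (\<Sum>c\<in>C. (inner c x / inner c c) *\<^sub>R c)" for x
  proof -
    define y where "y = x - (\<Sum>c\<in>C. (c \<bullet> x / (c \<bullet> c)) *\<^sub>R c)"
    have y: "inner c y = 0" if "c \<in> C" for c
    proof -
      have "(\<Sum>d\<in>C. (inner d x / inner d d) * inner c d) =
            (\<Sum>d\<in>C. if d = c then inner c x else 0)"
        using C(3) that by (intro sum.cong) (auto simp: pairwise_def orthogonal_def)
      then show ?thesis
        using C(1) that by (simp add: y_def inner_diff_right inner_sum_right)
    qed
    have "y \<in> span C" using B C by simp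
    then have "orthogonal y y"
      by (rule orthogonal_to_span) (simp add: orthogonal_def inner_commute y)
    then show ?thesis by (simp add: orthogonal_def y_def)
  qed
  then show ?thesis using C(1) by blast
qed

text \<open>The derivative \<open>Dg(f(x)) (Df(x) v)\<close> depends on \<open>x\<close> through both factors, whereas the
  recursion only provides \<open>Dg(\<cdot>) c\<close> for a fixed direction \<open>c\<close>. Expanding \<open>Df(x) v\<close> in a finite
  orthogonal spanning set turns the derivative into a finite sum of products of a \<open>C\<^sup>k\<close> coefficient
  with \<open>Dg(f(x)) c\<close>, to which the induction hypothesis applies. This is where finite dimension of
  the middle space enters.\<close>

lemma k_smooth_on_compose:
  fixes f :: "'a::real_normed_vector \<Rightarrow> 'b::fin_dim_inner"
    and g :: "'b \<Rightarrow> 'c::real_normed_vector"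
  assumes "open S" "k_smooth_on k S f" "k_smooth_on k T g" "f ` S \<subseteq> T"
  shows "k_smooth_on k S (\<lambda>x. g (f x))"
  using assms(2,3)
proof (induction k arbitrary: g)
  case 0
  then show ?case using assms(4) by (auto intro: continuous_on_compose2)
next
  case (Suc k)
  obtain C :: "'b set" where C: "finite C" "\<And>x. x = (\<Sum>c\<in>C. (inner c x / inner c c) *\<^sub>R c)"
    using fin_dim_inner_expansion by blast
  note f = Suc.prems(1) and g = Suc.prems(2)
  let ?Df = "\<lambda>x. frechet_derivative f (at x)"
    and ?Dg = "\<lambda>x. frechet_derivative g (at (f x))"
  have fT: "f x \<in> T" if "x \<in> S" for x using that assms(4) by blast
  have der: "((\<lambda>x. g (f x)) has_derivative
      (\<lambda>v. \<Sum>c\<in>C. (inner c (?Df x v) / inner c c) *\<^sub>R ?Dg x c)) (at x)" if "x \<in> S" for x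
  proof -
    note Dg = k_smooth_on_has_derivative[OF g fT[OF that]]
    have "?Dg x w = (\<Sum>c\<in>C. (inner c w / inner c c) *\<^sub>R ?Dg x c)" for w
      by (subst C(2)[of w])
         (simp only: linear_sum[OF has_derivative_linear[OF Dg]]
            linear_scale[OF has_derivative_linear[OF Dg]])
    then have "(\<lambda>v. ?Dg x (?Df x v)) =
        (\<lambda>v. \<Sum>c\<in>C. (inner c (?Df x v) / inner c c) *\<^sub>R ?Dg x c)"
      by (rule ext)
    with has_derivative_compose[OF k_smooth_on_has_derivative[OF f that] Dg]
    show ?thesis by (simp only:)
  qed
  show ?case
  proof (rule k_smooth_on_SucI[OF assms(1) der], assumption,
      rule k_smooth_on_sum[OF assms(1)], rule k_smooth_on_scaleR[OF assms(1)])
    fix v c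
    show "k_smooth_on k S (\<lambda>x. inner c (?Df x v) / inner c c)"
      by (rule k_smooth_on_bounded_linear[OF assms(1) _ k_smooth_on_frechet_derivative[OF f],
            of "\<lambda>w. inner c w / inner c c"])
         (intro bounded_linear_divide bounded_linear_inner_right
            bounded_linear_compose[OF bounded_linear_divide])
    show "k_smooth_on k S (\<lambda>x. ?Dg x c)"
      by (rule Suc.IH[OF k_smooth_on_SucD[OF f] k_smooth_on_frechet_derivative[OF g]])
  qed
qed

lemma smooth_onD: "smooth_on S f \<Longrightarrow> k_smooth_on k S f"
  by (simp add: smooth_on_def)

lemma smooth_onI: "(\<And>k. k_smooth_on k S f) \<Longrightarrow> smooth_on S f"
  by (simp add: smooth_on_def)

lemma smooth_on_compose:
  fixes f :: "'a::real_normed_vector \<Rightarrow> 'b::fin_dim_inner"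
  assumes "open S" "smooth_on S f" "smooth_on T g" "f ` S \<subseteq> T"
  shows "smooth_on S (g \<circ> f)"
  unfolding o_def
  by (rule smooth_onI,
      rule k_smooth_on_compose[OF assms(1) assms(2)[THEN smooth_onD] assms(3)[THEN smooth_onD] assms(4)])

lemma smooth_on_subset:
  assumes "smooth_on T f" "S \<subseteq> T"
  shows "smooth_on S f"
  by (rule smooth_onI, rule k_smooth_on_subset[OF assms(1)[THEN smooth_onD] assms(2)])

lemma smooth_on_cong:
  assumes "open S" "smooth_on S f" "\<And>x. x \<in> S \<Longrightarrow> g x = f x"
  shows "smooth_on S g"
  by (rule smooth_onI, rule k_smooth_on_cong[OF assms(1) assms(2)[THEN smooth_onD] assms(3)])

lemma smooth_on_local:
  assumes "\<And>x. x \<in> S \<Longrightarrow> \<exists>W. x \<in> W \<and> open W \<and> smooth_on W f"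
  shows "smooth_on S f"
  unfolding smooth_on_def
proof (intro allI k_smooth_on_local)
  fix k x assume "x \<in> S"
  from assms[OF this] show "\<exists>W. x \<in> W \<and> open W \<and> k_smooth_on k W f"
    by (auto simp: smooth_on_def)
qed

lemma smooth_on_const: "smooth_on S (\<lambda>x. c)"
  unfolding smooth_on_def by (intro allI k_smooth_on_const)

lemma smooth_on_bounded_linear:
  assumes "open S" "bounded_linear L" "smooth_on S f"
  shows "smooth_on S (\<lambda>x. L (f x))"
  by (rule smooth_onI, rule k_smooth_on_bounded_linear[OF assms(1,2) assms(3)[THEN smooth_onD]])

lemma smooth_on_add:
  assumes "open S" "smooth_on S f" "smooth_on S g"
  shows "smooth_on S (\<lambda>x. f x + g x)"
  by (rule smooth_onI, rule k_smooth_on_add[OF assms(1) assms(2,3)[THEN smooth_onD]])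

lemma smooth_on_mult:
  fixes f g :: "'a::real_normed_vector \<Rightarrow> real"
  assumes "open S" "smooth_on S f" "smooth_on S g"
  shows "smooth_on S (\<lambda>x. f x * g x)"
  unfolding real_scaleR_def[symmetric]
  by (rule smooth_onI, rule k_smooth_on_scaleR[OF assms(1) assms(2,3)[THEN smooth_onD]])

lemma smooth_on_imp_differentiable: "smooth_on S f \<Longrightarrow> x \<in> S \<Longrightarrow> f differentiable (at x)"
  unfolding smooth_on_def by (auto dest: spec[of _ "Suc 0"])

lemma smooth_on_Pair:
  assumes "open S" "smooth_on S f" "smooth_on S g"
  shows "smooth_on S (\<lambda>x. (f x, g x))"
proof -
  have L: "bounded_linear (\<lambda>y. (y, 0))" "bounded_linear (\<lambda>y. (0, y))"
    by (intro bounded_linear_Pair bounded_linear_ident bounded_linear_zero)+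
  show ?thesis
    using smooth_on_add[OF assms(1) smooth_on_bounded_linear[OF assms(1) L(1) assms(2)]
        smooth_on_bounded_linear[OF assms(1) L(2) assms(3)]] by simp
qed

section \<open>Smooth maps and functions on manifolds\<close>

text \<open>The part of the manifold structure on which the chain rule depends: charts separate points,
  carry open sets to open sets of the model space, and cover. It passes from the factors to the
  product manifold, the domain of the group multiplication.\<close>

definition open_charts :: "('a, 'e::fin_dim_inner) manifold \<Rightarrow> bool" where
  "open_charts M \<longleftrightarrow>
     (\<forall>(U, \<phi>) \<in> atlas M. openin (mtop M) U \<and> inj_on \<phi> U \<and>
        (\<forall>W. openin (mtop M) W \<and> W \<subseteq> U \<longrightarrow> open (\<phi> ` W))) \<and>
     (\<forall>p \<in> points M. \<exists>U \<phi>. (U, \<phi>) \<in> atlas M \<and> p \<in> U)"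

lemma open_chartsD:
  assumes "open_charts M" "(U, \<phi>) \<in> atlas M"
  shows "openin (mtop M) U" "inj_on \<phi> U" "U \<subseteq> points M"
    and "openin (mtop M) W \<Longrightarrow> W \<subseteq> U \<Longrightarrow> open (\<phi> ` W)"
proof -
  have *: "openin (mtop M) U \<and> inj_on \<phi> U \<and> (\<forall>W. openin (mtop M) W \<and> W \<subseteq> U \<longrightarrow> open (\<phi> ` W))"
    using assms unfolding open_charts_def by auto
  then show "openin (mtop M) U" "inj_on \<phi> U" by simp_all
  then show "U \<subseteq> points M" by (rule_tac openin_subset)
  show "openin (mtop M) W \<Longrightarrow> W \<subseteq> U \<Longrightarrow> open (\<phi> ` W)" using * by simp
qed

lemma open_charts_cover:
  assumes "open_charts M" "p \<in> points M"
  obtains U \<phi> where "(U, \<phi>) \<in> atlas M" "p \<in> U"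
  using assms unfolding open_charts_def by blast

lemma smooth_manifold_imp_open_charts:
  assumes "smooth_manifold M"
  shows "open_charts M"
proof -
  have "inj_on \<phi> U \<and> (\<forall>W. openin (mtop M) W \<and> W \<subseteq> U \<longrightarrow> open (\<phi> ` W))" if "(U, \<phi>) \<in> atlas M" for U \<phi>
  proof -
    have U: "openin (mtop M) U" "open (\<phi> ` U)"
      "homeomorphic_map (subtopology (mtop M) U) (top_of_set (\<phi> ` U)) \<phi>"
      using assms that unfolding smooth_manifold_def by auto
    have "open (\<phi> ` W)" if "openin (mtop M) W" "W \<subseteq> U" for W
    proof -
      have "openin (subtopology (mtop M) U) W"
        using that U(1) by (simp add: openin_open_subtopology)
      then have "openin (top_of_set (\<phi> ` U)) (\<phi> ` W)"
        using homeomorphic_imp_open_map[OF U(3)] by (simp add: open_map_def)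
      then show ?thesis using U(2) by (simp add: openin_open_eq)
    qed
    moreover have "inj_on \<phi> U"
      using homeomorphic_imp_injective_map[OF U(3)] openin_subset[OF U(1)] by (simp add: inf.absorb2)
    ultimately show ?thesis by blast
  qed
  moreover have "openin (mtop M) U" if "(U, \<phi>) \<in> atlas M" for U \<phi>
    using assms that unfolding smooth_manifold_def by auto
  moreover have "(\<Union>(U, \<phi>) \<in> atlas M. U) = points M"
    using assms unfolding smooth_manifold_def by blast
  then have "\<exists>U \<phi>. (U, \<phi>) \<in> atlas M \<and> p \<in> U" if "p \<in> points M" for p
    using that by blast
  ultimately show ?thesis unfolding open_charts_def by auto
qed

lemma open_charts_real_line: "open_charts real_line"
  by (auto simp: open_charts_def real_line_def)

lemma open_charts_product:
  assumes M: "open_charts M" and M': "open_charts M'"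
  shows "open_charts (product_manifold M M')"
proof -
  have "open (map_prod \<phi> \<psi> ` W)"
    if "(U, \<phi>) \<in> atlas M" "(V, \<psi>) \<in> atlas M'"
      and W: "openin (prod_topology (mtop M) (mtop M')) W" "W \<subseteq> U \<times> V" for U \<phi> V \<psi> W
  proof (subst open_subopen, intro ballI)
    fix z assume "z \<in> map_prod \<phi> \<psi> ` W"
    then obtain p q where pq: "(p, q) \<in> W" "z = (\<phi> p, \<psi> q)" by auto
    then obtain A B where AB: "openin (mtop M) A" "openin (mtop M') B" "p \<in> A" "q \<in> B" "A \<times> B \<subseteq> W"
      using openin_prod_topology_alt[THEN iffD1, OF W(1), rule_format, OF pq(1)] by blast
    have "A \<times> B \<subseteq> U \<times> V" using AB(5) W(2) by (rule subset_trans)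
    then have "A \<subseteq> U" "B \<subseteq> V" using AB(3,4) by (auto simp: times_subset_iff)
    then have "open (\<phi> ` A \<times> \<psi> ` B)"
      using AB(1,2) by (intro open_Times open_chartsD(4)[OF M that(1)] open_chartsD(4)[OF M' that(2)])
    moreover have "\<phi> ` A \<times> \<psi> ` B \<subseteq> map_prod \<phi> \<psi> ` W"
      using image_mono[OF AB(5), of "map_prod \<phi> \<psi>"] by (simp only: map_prod_surj_on[OF refl refl])
    moreover have "z \<in> \<phi> ` A \<times> \<psi> ` B"
      using pq(2) AB(3,4) by simp
    ultimately show "\<exists>T. open T \<and> z \<in> T \<and> T \<subseteq> map_prod \<phi> \<psi> ` W"
      by (intro exI conjI)
  qed
  moreover have "\<exists>A \<alpha>. (A, \<alpha>) \<in> atlas (product_manifold M M') \<and> z \<in> A"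
    if "z \<in> points (product_manifold M M')" for z
  proof -
    have "fst z \<in> points M" "snd z \<in> points M'"
      using that by (auto simp: product_manifold_def)
    then obtain U \<phi> V \<psi> where "(U, \<phi>) \<in> atlas M" "fst z \<in> U" "(V, \<psi>) \<in> atlas M'" "snd z \<in> V"
      using open_charts_cover[OF M] open_charts_cover[OF M'] by metis
    then have "(U \<times> V, map_prod \<phi> \<psi>) \<in> atlas (product_manifold M M')" "z \<in> U \<times> V"
      by (auto simp: product_manifold_def mem_Times_iff)
    then show ?thesis by blast
  qed
  moreover have "openin (mtop (product_manifold M M')) A \<and> inj_on \<alpha> A"
    if "(A, \<alpha>) \<in> atlas (product_manifold M M')" for A \<alpha>
    using that open_chartsD(1,2)[OF M] open_chartsD(1,2)[OF M']
    by (auto simp: product_manifold_def openin_prod_Times_iff intro: map_prod_inj_on)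
  ultimately show ?thesis
    unfolding open_charts_def by (auto simp: product_manifold_def)
qed

text \<open>The chain rule in charts. Near a given point, one chart of the middle manifold \<open>M'\<close> factors
  the coordinate expression into two smooth maps between model spaces. The map \<open>k\<close> stands both for
  a chart composed with a second smooth map and for a smooth function.\<close>

lemma smooth_on_chart_compose:
  fixes M :: "('a, 'e::fin_dim_inner) manifold" and M' :: "('b, 'f::fin_dim_inner) manifold"
  assumes M: "open_charts M" and M': "open_charts M'" and F: "smooth_map M M' F"
    and U: "(U, \<phi>) \<in> atlas M" and W: "openin (mtop M') W"
    and k: "\<And>V \<psi>. (V, \<psi>) \<in> atlas M' \<Longrightarrow> smooth_on (\<psi> ` (V \<inter> W)) (k \<circ> inv_into V \<psi>)"
  shows "smooth_on (\<phi> ` (U \<inter> F -` W)) (k \<circ> F \<circ> inv_into U \<phi>)"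
proof (rule smooth_on_local)
  fix y assume "y \<in> \<phi> ` (U \<inter> F -` W)"
  then obtain p where p: "p \<in> U" "F p \<in> W" "y = \<phi> p" by blast
  have "F p \<in> points M'" using openin_subset[OF W] p(2) by (rule subsetD)
  then obtain V \<psi> where V: "(V, \<psi>) \<in> atlas M'" "F p \<in> V"
    by (rule open_charts_cover[OF M'])
  note oc = open_chartsD[OF M U] and oc' = open_chartsD[OF M' V(1)]
  let ?S = "U \<inter> F -` (V \<inter> W)"
  have "openin (mtop M) (U \<inter> {x \<in> points M. F x \<in> V \<inter> W})"
  proof (rule openin_Int[OF oc(1) openin_continuous_map_preimage])
    show "continuous_map (mtop M) (mtop M') F" using F by (simp add: smooth_map_def)
  qed (rule openin_Int[OF oc'(1) W])
  moreover have "U \<inter> {x \<in> points M. F x \<in> V \<inter> W} = ?S" using oc(3) by blast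
  ultimately have S: "open (\<phi> ` ?S)" using oc(4) by simp
  have "smooth_on (\<phi> ` (U \<inter> F -` V)) (\<psi> \<circ> F \<circ> inv_into U \<phi>)"
    using F U V(1) unfolding smooth_map_def by fast
  then have f: "smooth_on (\<phi> ` ?S) (\<psi> \<circ> F \<circ> inv_into U \<phi>)"
    by (rule smooth_on_subset) blast
  have "smooth_on (\<phi> ` ?S) ((k \<circ> inv_into V \<psi>) \<circ> (\<psi> \<circ> F \<circ> inv_into U \<phi>))"
    by (rule smooth_on_compose[OF S f k[OF V(1)]]) (auto simp: inv_into_f_f[OF oc(2)])
  then have "smooth_on (\<phi> ` ?S) (k \<circ> F \<circ> inv_into U \<phi>)"
    by (rule smooth_on_cong[OF S]) (auto simp: inv_into_f_f[OF oc(2)] inv_into_f_f[OF oc'(2)])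
  moreover have "y \<in> \<phi> ` ?S" using p V(2) by auto
  ultimately show "\<exists>W. y \<in> W \<and> open W \<and> smooth_on W (k \<circ> F \<circ> inv_into U \<phi>)"
    using S by (intro exI conjI)
qed

lemma smooth_map_compose:
  assumes "open_charts M" "open_charts M'" "open_charts M''"
    and F: "smooth_map M M' F" and H: "smooth_map M' M'' H"
  shows "smooth_map M M'' (H \<circ> F)"
  unfolding smooth_map_def
proof (intro conjI ballI, safe)
  show "continuous_map (mtop M) (mtop M'') (H \<circ> F)"
    using F H continuous_map_compose unfolding smooth_map_def by blast
  fix U \<phi> V \<psi> assume U: "(U, \<phi>) \<in> atlas M" and V: "(V, \<psi>) \<in> atlas M''"
  let ?W = "{q \<in> points M'. H q \<in> V}"
  have Fp: "F p \<in> points M'" if "p \<in> U" for p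
    using that F open_chartsD(3)[OF assms(1) U] by (auto simp: smooth_map_def continuous_map_def)
  have "smooth_on (\<phi> ` (U \<inter> F -` ?W)) ((\<psi> \<circ> H) \<circ> F \<circ> inv_into U \<phi>)"
  proof (rule smooth_on_chart_compose[OF assms(1,2) F U])
    show "openin (mtop M') ?W"
      using H open_chartsD(1)[OF assms(3) V] openin_continuous_map_preimage
      unfolding smooth_map_def by blast
    fix A \<alpha> assume "(A, \<alpha>) \<in> atlas M'"
    moreover from open_chartsD(3)[OF assms(2) this] have "A \<inter> ?W = A \<inter> H -` V" by blast
    ultimately show "smooth_on (\<alpha> ` (A \<inter> ?W)) ((\<psi> \<circ> H) \<circ> inv_into A \<alpha>)"
      using H V unfolding smooth_map_def by auto
  qed
  moreover have "U \<inter> F -` ?W = U \<inter> (H \<circ> F) -` V" using Fp by auto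
  ultimately show "smooth_on (\<phi> ` (U \<inter> (H \<circ> F) -` V)) (\<psi> \<circ> (H \<circ> F) \<circ> inv_into U \<phi>)"
    by (simp add: o_assoc)
qed

lemma smooth_functionsI:
  assumes "open_charts M"
    and "\<And>U \<phi>. (U, \<phi>) \<in> atlas M \<Longrightarrow> smooth_on (\<phi> ` U) (\<lambda>y. h (inv_into U \<phi> y))"
  shows "(\<lambda>x\<in>points M. h x) \<in> smooth_functions M"
proof -
  have "smooth_on (\<phi> ` U) ((\<lambda>x\<in>points M. h x) \<circ> inv_into U \<phi>)" if U: "(U, \<phi>) \<in> atlas M" for U \<phi>
  proof (rule smooth_on_cong[OF _ assms(2)[OF U]])
    note oc = open_chartsD[OF assms(1) U]
    show "open (\<phi> ` U)" by (rule oc(4)[OF oc(1) subset_refl])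
    fix y assume "y \<in> \<phi> ` U"
    then have "inv_into U \<phi> y \<in> points M"
      using oc(3) by (auto simp: inv_into_f_f[OF oc(2)])
    then show "((\<lambda>x\<in>points M. h x) \<circ> inv_into U \<phi>) y = h (inv_into U \<phi> y)"
      by simp
  qed
  then show ?thesis by (auto simp: smooth_functions_def)
qed

lemma smooth_functionsD:
  assumes "f \<in> smooth_functions M" "(U, \<phi>) \<in> atlas M"
  shows "smooth_on (\<phi> ` U) (\<lambda>y. f (inv_into U \<phi> y))"
  using assms by (auto simp: smooth_functions_def o_def)

lemma smooth_functions_mult:
  assumes M: "open_charts M" and f: "f \<in> smooth_functions M" and g: "g \<in> smooth_functions M"
  shows "(\<lambda>x\<in>points M. f x * g x) \<in> smooth_functions M"
proof (rule smooth_functionsI[OF M])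
  fix U \<phi> assume U: "(U, \<phi>) \<in> atlas M"
  note oc = open_chartsD[OF M U]
  show "smooth_on (\<phi> ` U) (\<lambda>y. f (inv_into U \<phi> y) * g (inv_into U \<phi> y))"
    by (rule smooth_on_mult[OF oc(4)[OF oc(1) subset_refl] smooth_functionsD[OF f U]
          smooth_functionsD[OF g U]])
qed

lemma smooth_functions_lincomb:
  assumes M: "open_charts M" and f: "f \<in> smooth_functions M" and g: "g \<in> smooth_functions M"
  shows "(\<lambda>x\<in>points M. a * f x + b * g x) \<in> smooth_functions M"
proof (rule smooth_functionsI[OF M])
  fix U \<phi> assume U: "(U, \<phi>) \<in> atlas M"
  note oc = open_chartsD[OF M U]
  note op = oc(4)[OF oc(1) subset_refl]
  show "smooth_on (\<phi> ` U) (\<lambda>y. a * f (inv_into U \<phi> y) + b * g (inv_into U \<phi> y))"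
    by (rule smooth_on_add[OF op smooth_on_mult[OF op smooth_on_const smooth_functionsD[OF f U]]
          smooth_on_mult[OF op smooth_on_const smooth_functionsD[OF g U]]])
qed

lemma smooth_functions_pullback:
  assumes M: "open_charts M" and M': "open_charts M'" and F: "smooth_map M M' F"
    and h: "h \<in> smooth_functions M'"
  shows "(\<lambda>x\<in>points M. h (F x)) \<in> smooth_functions M"
proof (rule smooth_functionsI[OF M])
  fix U \<phi> assume U: "(U, \<phi>) \<in> atlas M"
  have "smooth_on (\<phi> ` (U \<inter> F -` points M')) (h \<circ> F \<circ> inv_into U \<phi>)"
  proof (rule smooth_on_chart_compose[OF M M' F U])
    fix V \<psi> assume V: "(V, \<psi>) \<in> atlas M'"
    then have "V \<inter> points M' = V" using open_chartsD(3)[OF M'] by blast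
    then show "smooth_on (\<psi> ` (V \<inter> points M')) (h \<circ> inv_into V \<psi>)"
      using smooth_functionsD[OF h V] by (simp add: o_def)
  qed simp
  moreover have "U \<inter> F -` points M' = U"
    using F open_chartsD(3)[OF M U] by (auto simp: smooth_map_def continuous_map_def)
  ultimately show "smooth_on (\<phi> ` U) (\<lambda>y. h (F (inv_into U \<phi> y)))"
    by (simp add: o_def)
qed

lemma smooth_map_Pair_left:
  assumes M: "smooth_manifold M" and M': "open_charts M'" and "g \<in> points M'"
  shows "smooth_map M (product_manifold M' M) (\<lambda>h. (g, h))"
  unfolding smooth_map_def
proof (intro conjI ballI, safe)
  show "continuous_map (mtop M) (mtop (product_manifold M' M)) (Pair g)"
    using assms(3) by (simp add: product_manifold_def continuous_map_pairwise o_def)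
  fix U \<phi> V \<psi> assume U: "(U, \<phi>) \<in> atlas M" and "(V, \<psi>) \<in> atlas (product_manifold M' M)"
  then obtain A \<alpha> B \<beta> where AB: "(A, \<alpha>) \<in> atlas M'" "(B, \<beta>) \<in> atlas M"
    "V = A \<times> B" "\<psi> = map_prod \<alpha> \<beta>"
    by (auto simp: product_manifold_def)
  note oc = open_chartsD[OF smooth_manifold_imp_open_charts[OF M]]
  have "open (\<phi> ` (U \<inter> B))"
    using oc(4)[OF U openin_Int[OF oc(1)[OF U] oc(1)[OF AB(2)]]] by simp
  moreover have "smooth_on (\<phi> ` (U \<inter> B)) (\<beta> \<circ> inv_into U \<phi>)"
    using M U AB(2) unfolding smooth_manifold_def by fast
  ultimately have "smooth_on (\<phi> ` (U \<inter> B)) (\<lambda>y. (\<alpha> g, (\<beta> \<circ> inv_into U \<phi>) y))"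
    by (intro smooth_on_Pair smooth_on_const)
  then have "smooth_on (\<phi> ` (U \<inter> B)) (\<psi> \<circ> Pair g \<circ> inv_into U \<phi>)"
    by (simp add: AB(4) o_def)
  then show "smooth_on (\<phi> ` (U \<inter> Pair g -` V)) (\<psi> \<circ> Pair g \<circ> inv_into U \<phi>)"
    by (rule smooth_on_subset) (auto simp: AB(3))
qed

lemma smooth_map_Pair_right:
  assumes M: "smooth_manifold M" and M': "open_charts M'" and "g \<in> points M'"
  shows "smooth_map M (product_manifold M M') (\<lambda>h. (h, g))"
  unfolding smooth_map_def
proof (intro conjI ballI, safe)
  show "continuous_map (mtop M) (mtop (product_manifold M M')) (\<lambda>h. (h, g))"
    using assms(3) by (simp add: product_manifold_def continuous_map_pairwise o_def)
  fix U \<phi> V \<psi> assume U: "(U, \<phi>) \<in> atlas M" and "(V, \<psi>) \<in> atlas (product_manifold M M')"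
  then obtain A \<alpha> B \<beta> where AB: "(A, \<alpha>) \<in> atlas M" "(B, \<beta>) \<in> atlas M'"
    "V = A \<times> B" "\<psi> = map_prod \<alpha> \<beta>"
    by (auto simp: product_manifold_def)
  note oc = open_chartsD[OF smooth_manifold_imp_open_charts[OF M]]
  have "open (\<phi> ` (U \<inter> A))"
    using oc(4)[OF U openin_Int[OF oc(1)[OF U] oc(1)[OF AB(1)]]] by simp
  moreover have "smooth_on (\<phi> ` (U \<inter> A)) (\<alpha> \<circ> inv_into U \<phi>)"
    using M U AB(1) unfolding smooth_manifold_def by fast
  ultimately have "smooth_on (\<phi> ` (U \<inter> A)) (\<lambda>y. ((\<alpha> \<circ> inv_into U \<phi>) y, \<beta> g))"
    by (intro smooth_on_Pair smooth_on_const)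
  then have "smooth_on (\<phi> ` (U \<inter> A)) (\<psi> \<circ> (\<lambda>h. (h, g)) \<circ> inv_into U \<phi>)"
    by (simp add: AB(4) o_def)
  then show "smooth_on (\<phi> ` (U \<inter> (\<lambda>h. (h, g)) -` V)) (\<psi> \<circ> (\<lambda>h. (h, g)) \<circ> inv_into U \<phi>)"
    by (rule smooth_on_subset) (auto simp: AB(3))
qed

section \<open>Tangent vectors of curves\<close>

lemma tangent_vector_extensional:
  "v \<in> tangent_space M p \<Longrightarrow> v \<in> extensional (smooth_functions M)"
  by (simp add: tangent_space_def)

lemma smooth_curve_in_points: "smooth_map real_line M c \<Longrightarrow> c t \<in> points M"
  by (auto simp: smooth_map_def real_line_def continuous_map_def)

lemma smooth_function_along_curve:
  assumes M: "open_charts M" and c: "smooth_map real_line M c" and f: "f \<in> smooth_functions M"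
  shows "((\<lambda>s. f (c s)) has_real_derivative deriv (\<lambda>s. f (c s)) t) (at t)"
proof -
  have "(\<lambda>s\<in>points real_line. f (c s)) \<in> smooth_functions real_line"
    by (rule smooth_functions_pullback[OF open_charts_real_line M c f])
  then have "smooth_on UNIV (\<lambda>s. f (c s))"
    by (simp add: smooth_functions_def real_line_def restrict_def)
  then have "(\<lambda>s. f (c s)) differentiable (at t)"
    by (rule smooth_on_imp_differentiable) simp
  then show ?thesis
    by (simp add: DERIV_deriv_iff_real_differentiable)
qed

text \<open>Linearity and the Leibniz rule are those of \<open>d/dt\<close>. The derivation must be evaluated at
  linear combinations and products of smooth functions, and it takes a default value outside
  \<open>smooth_functions M\<close>, so closure of that set is needed.\<close>

lemma velocity_in_tangent_space:
  assumes M: "open_charts M" and c: "smooth_map real_line M c"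
  shows "velocity M c t \<in> tangent_space M (c t)"
proof -
  note der = smooth_function_along_curve[OF M c]
  note pts = smooth_curve_in_points[OF c]
  have mem: "(\<lambda>x\<in>points M. a * f x + b * g x) \<in> smooth_functions M"
      "(\<lambda>x\<in>points M. f x * g x) \<in> smooth_functions M"
    if "f \<in> smooth_functions M" "g \<in> smooth_functions M" for f g a b
    using that by (auto intro: smooth_functions_lincomb[OF M] smooth_functions_mult[OF M])
  have "deriv (\<lambda>s. (\<lambda>x\<in>points M. a * f x + b * g x) (c s)) t =
      a * deriv (\<lambda>s. f (c s)) t + b * deriv (\<lambda>s. g (c s)) t"
    if "f \<in> smooth_functions M" "g \<in> smooth_functions M" for f g a b
    using DERIV_imp_deriv[OF DERIV_add[OF DERIV_cmult[OF der[OF that(1)]] DERIV_cmult[OF der[OF that(2)]]]]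
    by (simp add: pts)
  moreover have "deriv (\<lambda>s. (\<lambda>x\<in>points M. f x * g x) (c s)) t =
      f (c t) * deriv (\<lambda>s. g (c s)) t + g (c t) * deriv (\<lambda>s. f (c s)) t"
    if "f \<in> smooth_functions M" "g \<in> smooth_functions M" for f g
    using DERIV_imp_deriv[OF DERIV_mult[OF der[OF that(1)] der[OF that(2)]]]
    by (simp add: pts algebra_simps)
  ultimately show ?thesis
    by (simp add: tangent_space_def velocity_def mem)
qed

lemma tangent_map_velocity:
  assumes "open_charts M" "open_charts M'" "smooth_map M M' F" "smooth_map real_line M c"
  shows "tangent_map M M' F (velocity M c t) = velocity M' (F \<circ> c) t"
proof (rule ext)
  fix h
  show "tangent_map M M' F (velocity M c t) h = velocity M' (F \<circ> c) t h"
    using smooth_functions_pullback[OF assms(1-3), of h] smooth_curve_in_points[OF assms(4)]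
    by (auto simp: tangent_map_def velocity_def)
qed

lemma tangent_map_lincomb:
  assumes "open_charts M" "open_charts M'" "smooth_map M M' F"
  shows "tangent_map M M' F (lincomb M a u b v) =
    lincomb M' a (tangent_map M M' F u) b (tangent_map M M' F v)"
proof (rule ext)
  fix h
  show "tangent_map M M' F (lincomb M a u b v) h =
      lincomb M' a (tangent_map M M' F u) b (tangent_map M M' F v) h"
    using smooth_functions_pullback[OF assms, of h]
    by (auto simp: tangent_map_def lincomb_def)
qed

section \<open>The adjoint action\<close>

locale lie_group_with_normal =
  fixes G :: "'g monoid" (structure)
    and M :: "('g, 'e::fin_dim_inner) manifold" and N :: "'g set"
  assumes lie: "lie_group G M" and normal: "N \<lhd> G"
begin

sublocale group G using lie by (simp add: lie_group_def)

abbreviation (input) conj_by :: "'g \<Rightarrow> 'g \<Rightarrow> 'g" where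
  "conj_by g \<equiv> \<lambda>h. g \<otimes> h \<otimes> inv g"

abbreviation (input) LN where "LN \<equiv> subgroup_lie_algebra G M N"

lemma points_eq: "points M = carrier G"
  using lie by (simp add: lie_group_def)

lemma charts: "open_charts M"
  using lie by (simp add: lie_group_def smooth_manifold_imp_open_charts)

text \<open>Conjugation is the composite \<open>h \<mapsto> (g, h) \<mapsto> gh \<mapsto> (gh, g\<^sup>-\<^sup>1) \<mapsto> ghg\<^sup>-\<^sup>1\<close> of smooth maps.\<close>

lemma smooth_conj:
  assumes g: "g \<in> carrier G"
  shows "smooth_map M M (conj_by g)"
proof -
  have M: "smooth_manifold M" and mult: "smooth_map (product_manifold M M) M (\<lambda>(g, h). g \<otimes> h)"
    using lie by (auto simp: lie_group_def)
  have gs: "g \<in> points M" "inv g \<in> points M" using g by (auto simp: points_eq)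
  note comp = smooth_map_compose[OF charts open_charts_product[OF charts charts] charts _ mult]
  show ?thesis
    using smooth_map_compose[OF charts charts charts
        comp[OF smooth_map_Pair_left[OF M charts gs(1)]]
        comp[OF smooth_map_Pair_right[OF M charts gs(2)]]]
    by (simp add: o_def)
qed

lemma one_parameter_subgroup_conj:
  assumes g: "g \<in> carrier G" and c: "one_parameter_subgroup G M c"
  shows "one_parameter_subgroup G M (conj_by g \<circ> c)"
proof -
  have cs: "smooth_map real_line M c" and add: "c (s + t) = c s \<otimes> c t" for s t
    using c by (auto simp: one_parameter_subgroup_def)
  have [simp]: "c t \<in> carrier G" for t
    using smooth_curve_in_points[OF cs] by (simp add: points_eq)
  have "conj_by g (c (s + t)) = conj_by g (c s) \<otimes> conj_by g (c t)" for s t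
    using g by (simp add: add m_assoc) (simp add: m_assoc[symmetric])
  then show ?thesis
    using smooth_map_compose[OF open_charts_real_line charts charts cs smooth_conj[OF g]]
    by (simp add: one_parameter_subgroup_def)
qed

lemma one_parameter_subgroup_zero:
  assumes "one_parameter_subgroup G M c"
  shows "c 0 = \<one>"
proof -
  have cs: "smooth_map real_line M c" and add: "c (0 + 0) = c 0 \<otimes> c 0"
    using assms unfolding one_parameter_subgroup_def by blast+
  have "c 0 \<in> carrier G"
    using smooth_curve_in_points[OF cs] by (simp add: points_eq)
  then show ?thesis using add by (simp add: r_cancel_one')
qed

text \<open>Without this inclusion, restricting a form on the Lie algebra of \<open>G\<close> to \<open>\<nn>\<close> would pick up
  default values of extensional functions.\<close>

lemma subgroup_lie_algebra_subset: "LN \<subseteq> lie_algebra G M"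
proof
  fix Z assume "Z \<in> LN"
  then obtain c where "Z = velocity M c 0" and c: "one_parameter_subgroup G M c"
    by (auto simp: subgroup_lie_algebra_def)
  then show "Z \<in> lie_algebra G M"
    using velocity_in_tangent_space[OF charts, of c 0] one_parameter_subgroup_zero[OF c]
    by (simp add: lie_algebra_def one_parameter_subgroup_def)
qed

text \<open>This is where normality of \<open>N\<close> makes \<open>G\<close> act on \<open>\<nn>\<^sup>*\<close>: conjugation carries one-parameter
  subgroups of \<open>N\<close> to one-parameter subgroups of \<open>N\<close>.\<close>

lemma Ad_subgroup_lie_algebra:
  assumes g: "g \<in> carrier G" and Z: "Z \<in> LN"
  shows "Ad G M g Z \<in> LN"
proof -
  obtain c where c: "Z = velocity M c 0" "one_parameter_subgroup G M c" "\<And>t. c t \<in> N"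
    using Z by (auto simp: subgroup_lie_algebra_def)
  have "Ad G M g Z = velocity M (conj_by g \<circ> c) 0"
    unfolding Ad_def c(1)
    using c(2) by (intro tangent_map_velocity[OF charts charts smooth_conj[OF g]])
      (simp add: one_parameter_subgroup_def)
  moreover have "(conj_by g \<circ> c) t \<in> N" for t
    using normal.inv_op_closed2[OF normal g c(3)] by simp
  ultimately show ?thesis
    using one_parameter_subgroup_conj[OF g c(2)] by (auto simp: subgroup_lie_algebra_def)
qed

lemma Ad_lincomb:
  assumes "g \<in> carrier G"
  shows "Ad G M g (lincomb M a u b v) = lincomb M a (Ad G M g u) b (Ad G M g v)"
  unfolding Ad_def by (rule tangent_map_lincomb[OF charts charts smooth_conj[OF assms]])

text \<open>Both sides are compared at all functions: at smooth functions conjugation by the identity is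
  invisible because these are extensional, elsewhere both sides take the default value.\<close>

lemma Ad_one:
  assumes "Z \<in> lie_algebra G M"
  shows "Ad G M \<one> Z = Z"
proof (rule ext)
  fix f
  show "Ad G M \<one> Z f = Z f"
  proof (cases "f \<in> smooth_functions M")
    case True
    then have "f \<in> extensional (points M)" by (simp add: smooth_functions_def)
    then have "(\<lambda>x\<in>points M. f (conj_by \<one> x)) = f"
      by (intro extensionalityI[of _ "points M"]) (auto simp: points_eq)
    then show ?thesis using True by (simp add: Ad_def tangent_map_def)
  next
    case False
    then show ?thesis
      using extensional_arb[OF tangent_vector_extensional[OF assms[unfolded lie_algebra_def]] False]
      by (simp add: Ad_def tangent_map_def)
  qed
qed

lemma Ad_mult:
  assumes g: "g \<in> carrier G" and h: "h \<in> carrier G"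
  shows "Ad G M (g \<otimes> h) Z = Ad G M g (Ad G M h Z)"
proof (rule ext)
  fix f :: "'g \<Rightarrow> real"
  have "(\<lambda>x\<in>points M. f (conj_by (g \<otimes> h) x)) =
      (\<lambda>x\<in>points M. (\<lambda>y\<in>points M. f (conj_by g y)) (conj_by h x))"
    using g h by (auto simp: points_eq fun_eq_iff m_assoc inv_mult_group)
  then show "Ad G M (g \<otimes> h) Z f = Ad G M g (Ad G M h Z) f"
    using smooth_functions_pullback[OF charts charts smooth_conj[OF g], of f]
    by (simp add: Ad_def tangent_map_def)
qed

section \<open>The coadjoint action\<close>

lemma coad_closed:
  assumes g: "g \<in> carrier G" and m: "m \<in> sub_dual G M N"
  shows "sub_coad G M N g m \<in> sub_dual G M N"
proof -
  let ?A = "Ad G M (inv g)"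
  have A: "?A Z \<in> LN" if "Z \<in> LN" for Z using Ad_subgroup_lie_algebra[OF _ that] g by simp
  have "m (?A w) = a * m (?A u) + b * m (?A v)"
    if "u \<in> LN" "v \<in> LN" "w \<in> LN" "w = lincomb M a u b v" for u v w a b
    using m A[OF that(1)] A[OF that(2)] A[OF that(3)] Ad_lincomb[of "inv g" a u b v] g that(4)
    unfolding dual_space_def by simp
  then show ?thesis using m by (auto simp: coad_def dual_space_def)
qed

lemma coad_apply:
  assumes "m \<in> sub_dual G M N" "Z \<in> LN"
  shows "sub_coad G M N g m Z = m (Ad G M (inv g) Z)"
  using assms by (simp add: coad_def)

lemma sub_dual_eqI:
  assumes "m \<in> sub_dual G M N" "m' \<in> sub_dual G M N" "\<And>Z. Z \<in> LN \<Longrightarrow> m Z = m' Z"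
  shows "m = m'"
proof (rule extensionalityI)
  show "m \<in> extensional LN" "m' \<in> extensional LN"
    using assms(1,2) by (simp_all add: dual_space_def)
qed (rule assms(3))

lemma coad_mult:
  assumes g: "g \<in> carrier G" and h: "h \<in> carrier G" and m: "m \<in> sub_dual G M N"
  shows "sub_coad G M N (g \<otimes> h) m = sub_coad G M N g (sub_coad G M N h m)"
proof (rule sub_dual_eqI)
  show "sub_coad G M N (g \<otimes> h) m \<in> sub_dual G M N"
    by (rule coad_closed[OF m_closed[OF g h] m])
  show "sub_coad G M N g (sub_coad G M N h m) \<in> sub_dual G M N"
    by (rule coad_closed[OF g coad_closed[OF h m]])
  fix Z assume Z: "Z \<in> LN"
  have "Ad G M (inv (g \<otimes> h)) Z = Ad G M (inv h) (Ad G M (inv g) Z)"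
    using Ad_mult[OF inv_closed[OF h] inv_closed[OF g]] by (simp only: inv_mult_group[OF g h])
  then show "sub_coad G M N (g \<otimes> h) m Z = sub_coad G M N g (sub_coad G M N h m) Z"
    by (simp only: coad_apply[OF m Z] coad_apply[OF coad_closed[OF h m] Z]
          coad_apply[OF m Ad_subgroup_lie_algebra[OF inv_closed[OF g] Z]])
qed

lemma coad_one:
  assumes m: "m \<in> sub_dual G M N"
  shows "sub_coad G M N \<one> m = m"
proof (rule sub_dual_eqI[OF coad_closed[OF one_closed m] m])
  fix Z assume Z: "Z \<in> LN"
  show "sub_coad G M N \<one> m Z = m Z"
    by (simp only: coad_apply[OF m Z] inv_one Ad_one[OF subsetD[OF subgroup_lie_algebra_subset Z]])
qed

lemma restrict_form_in_dual:
  assumes "m \<in> dual_space M (lie_algebra G M)"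
  shows "restrict_form G M N m \<in> sub_dual G M N"
proof -
  have "m w = a * m u + b * m v"
    if "u \<in> LN" "v \<in> LN" "w \<in> LN" "w = lincomb M a u b v" for u v w a b
    using assms that(4) that(1-3)[THEN subsetD[OF subgroup_lie_algebra_subset]]
    unfolding dual_space_def by simp
  then show ?thesis by (auto simp: restrict_form_def dual_space_def)
qed

text \<open>Equivariance of the restriction \<open>\<gg>\<^sup>* \<rightarrow> \<nn>\<^sup>*\<close>: the two contragredient actions use the same
  operator \<open>Ad(g\<^sup>-\<^sup>1)\<close>, which does not leave \<open>\<nn>\<close>.\<close>

lemma restrict_form_coad:
  assumes g: "g \<in> carrier G" and m: "m \<in> dual_space M (lie_algebra G M)"
  shows "restrict_form G M N (coad G M (lie_algebra G M) g m) =
    sub_coad G M N g (restrict_form G M N m)"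
proof (rule extensionalityI)
  show "restrict_form G M N (coad G M (lie_algebra G M) g m) \<in> extensional LN"
    by (simp add: restrict_form_def)
  show "sub_coad G M N g (restrict_form G M N m) \<in> extensional LN"
    using coad_closed[OF g restrict_form_in_dual[OF m]] by (simp add: dual_space_def)
  fix Z assume Z: "Z \<in> LN"
  have "restrict_form G M N (coad G M (lie_algebra G M) g m) Z = m (Ad G M (inv g) Z)"
    using Z subsetD[OF subgroup_lie_algebra_subset Z] m by (simp add: restrict_form_def coad_def)
  also have "\<dots> = sub_coad G M N g (restrict_form G M N m) Z"
    unfolding coad_apply[OF restrict_form_in_dual[OF m] Z]
    using Ad_subgroup_lie_algebra[OF inv_closed[OF g] Z] by (simp add: restrict_form_def)
  finally show "restrict_form G M N (coad G M (lie_algebra G M) g m) Z =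
      sub_coad G M N g (restrict_form G M N m) Z" .
qed

end

section \<open>Group actions on orbit spaces of normal subgroups\<close>

lemma group_actionI:
  assumes "group G"
    and ext: "\<And>g. g \<in> carrier G \<Longrightarrow> \<phi> g \<in> extensional E"
    and closed: "\<And>g x. g \<in> carrier G \<Longrightarrow> x \<in> E \<Longrightarrow> \<phi> g x \<in> E"
    and mult: "\<And>g h x. g \<in> carrier G \<Longrightarrow> h \<in> carrier G \<Longrightarrow> x \<in> E \<Longrightarrow>
      \<phi> (g \<otimes>\<^bsub>G\<^esub> h) x = \<phi> g (\<phi> h x)"
    and one: "\<And>x. x \<in> E \<Longrightarrow> \<phi> \<one>\<^bsub>G\<^esub> x = x"
  shows "group_action G E \<phi>"
proof -
  interpret group G by fact
  have Bij: "\<phi> g \<in> Bij E" if g: "g \<in> carrier G" for g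
  proof -
    have "\<phi> (inv\<^bsub>G\<^esub> g) (\<phi> g x) = x" "\<phi> g (\<phi> (inv\<^bsub>G\<^esub> g) x) = x" if "x \<in> E" for x
      using mult[of "inv\<^bsub>G\<^esub> g" g x] mult[of g "inv\<^bsub>G\<^esub> g" x] that g one by auto
    then have "bij_betw (\<phi> g) E E"
      using g closed by (intro bij_betwI[of _ _ _ "\<phi> (inv\<^bsub>G\<^esub> g)"]) auto
    then show ?thesis using ext[OF g] by (simp add: Bij_def)
  qed
  have "\<phi> (g \<otimes>\<^bsub>G\<^esub> h) = compose E (\<phi> g) (\<phi> h)" if "g \<in> carrier G" "h \<in> carrier G" for g h
    using that ext[of "g \<otimes>\<^bsub>G\<^esub> h"] mult
    by (intro extensionalityI[of _ E]) (auto simp: compose_def)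
  then have "\<phi> \<in> hom G (BijGroup E)"
    using Bij by (auto simp: hom_def BijGroup_def)
  then show ?thesis
    by (simp add: group_action_def group_hom_def group_hom_axioms_def group_BijGroup is_group)
qed

context group_action
begin

text \<open>From \<open>gn = (gng\<^sup>-\<^sup>1)g\<close> and \<open>ng = g(g\<^sup>-\<^sup>1ng)\<close>, with both conjugates in \<open>N\<close>.\<close>

lemma image_normal_orbit:
  assumes N: "N \<lhd> G" and g: "g \<in> carrier G" and x: "x \<in> E"
  shows "\<phi> g ` orbit (G\<lparr>carrier := N\<rparr>) \<phi> x = orbit (G\<lparr>carrier := N\<rparr>) \<phi> (\<phi> g x)"
proof -
  interpret normal N G by fact
  have "\<phi> g (\<phi> n x) \<in> orbit (G\<lparr>carrier := N\<rparr>) \<phi> (\<phi> g x)" if n: "n \<in> N" for n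
  proof -
    have n': "n \<in> carrier G" using n by simp
    have "\<phi> g (\<phi> n x) = \<phi> (g \<otimes> n \<otimes> inv g \<otimes> g) x"
      using g n' by (simp add: composition_rule[OF x, symmetric] m_assoc)
    also have "\<dots> = \<phi> (g \<otimes> n \<otimes> inv g) (\<phi> g x)"
      using g n' by (simp add: composition_rule[OF x])
    finally show ?thesis
      using inv_op_closed2[OF g n] by (auto simp: orbit_def)
  qed
  moreover have "\<phi> n (\<phi> g x) \<in> \<phi> g ` orbit (G\<lparr>carrier := N\<rparr>) \<phi> x" if n: "n \<in> N" for n
  proof -
    have n': "n \<in> carrier G" using n by simp
    have "g \<otimes> (inv g \<otimes> n \<otimes> g) = n \<otimes> g"
      using g n' by (simp add: m_assoc[symmetric])
    then have "\<phi> n (\<phi> g x) = \<phi> (g \<otimes> (inv g \<otimes> n \<otimes> g)) x"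
      using g n' by (simp add: composition_rule[OF x, symmetric])
    also have "\<dots> = \<phi> g (\<phi> (inv g \<otimes> n \<otimes> g) x)"
      using g n' by (simp add: composition_rule[OF x])
    finally show ?thesis
      using inv_op_closed1[OF g n] by (auto simp: orbit_def)
  qed
  ultimately show ?thesis
    by (auto simp: orbit_def)
qed

lemma action_on_normal_orbits:
  assumes N: "N \<lhd> G"
  shows "group_action G (orbits (G\<lparr>carrier := N\<rparr>) E \<phi>)
    (\<lambda>g. \<lambda>U\<in>orbits (G\<lparr>carrier := N\<rparr>) E \<phi>. \<phi> g ` U)"
proof -
  interpret normal N G by fact
  let ?O = "orbits (G\<lparr>carrier := N\<rparr>) E \<phi>"
  have orbits: "\<exists>x\<in>E. U = orbit (G\<lparr>carrier := N\<rparr>) \<phi> x" if "U \<in> ?O" for U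
    using that by (auto simp: orbits_def)
  have sub: "U \<subseteq> E" if "U \<in> ?O" for U
  proof -
    obtain x where "x \<in> E" "U = orbit (G\<lparr>carrier := N\<rparr>) \<phi> x" using orbits \<open>U \<in> ?O\<close> by blast
    then show ?thesis using element_image[OF mem_carrier] by (auto simp: orbit_def)
  qed
  have closed: "\<phi> g ` U \<in> ?O" if g: "g \<in> carrier G" and "U \<in> ?O" for g U
  proof -
    obtain x where x: "x \<in> E" "U = orbit (G\<lparr>carrier := N\<rparr>) \<phi> x" using orbits \<open>U \<in> ?O\<close> by blast
    have "\<phi> g x \<in> E" by (rule element_image[OF g x(1) refl])
    then show ?thesis
      using image_normal_orbit[OF N g x(1)] x(2) unfolding orbits_def by blast
  qed
  show ?thesis
  proof (rule group_actionI)
    fix g h U assume gh: "g \<in> carrier G" "h \<in> carrier G" and U: "U \<in> ?O"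
    have "\<phi> (g \<otimes> h) ` U = \<phi> g ` \<phi> h ` U"
      unfolding image_image using composition_rule[OF _ gh] sub[OF U]
      by (intro image_cong refl) (simp add: subset_iff)
    then show "(\<lambda>U\<in>?O. \<phi> (g \<otimes> h) ` U) U = (\<lambda>U\<in>?O. \<phi> g ` U) ((\<lambda>U\<in>?O. \<phi> h ` U) U)"
      using U closed[OF gh(2) U] by simp
  next
    fix U assume U: "U \<in> ?O"
    have "\<phi> \<one> ` U = (\<lambda>x. x) ` U"
      using sub[OF U] by (intro image_cong) (auto simp: id_eq_one[symmetric])
    then show "(\<lambda>U\<in>?O. \<phi> \<one> ` U) U = U" using U by simp
  qed (simp_all add: closed is_group)
qed

text \<open>The identification \<open>G/G\<^sub>x = G(x)\<close> with left cosets, natural in that \<open>gG\<^sub>x\<close> corresponds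
  to \<open>g(x)\<close>. All elements of a left coset move \<open>x\<close> to the same point, so the point can be selected
  by a definite description.\<close>

lemma lcosets_stabilizer_bij_orbit:
  assumes x: "x \<in> E"
  shows "\<exists>\<beta>. bij_betw \<beta> (lcosets\<^bsub>G\<^esub> (stabilizer G \<phi> x)) (orbit G \<phi> x) \<and>
    (\<forall>g \<in> carrier G. \<beta> (g <#\<^bsub>G\<^esub> stabilizer G \<phi> x) = \<phi> g x)"
proof -
  let ?H = "stabilizer G \<phi> x"
  interpret group G by (rule group_hom.axioms(1)[OF group_hom])
  have H: "subgroup ?H G" by (rule stabilizer_subgroup[OF x])
  define \<beta> where "\<beta> C = (THE y. \<exists>g \<in> C. y = \<phi> g x)" for C
  have coset: "\<phi> h x = \<phi> g x" if g: "g \<in> carrier G" and h: "h \<in> g <#\<^bsub>G\<^esub> ?H" for g h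
  proof -
    obtain k where k: "k \<in> ?H" "h = g \<otimes> k" using h unfolding l_coset_def by blast
    then have "k \<in> carrier G" "\<phi> k x = x" by (simp_all add: stabilizer_def)
    then show ?thesis using composition_rule[OF x g] k(2) by simp
  qed
  have \<beta>: "\<beta> (g <#\<^bsub>G\<^esub> ?H) = \<phi> g x" if g: "g \<in> carrier G" for g
    unfolding \<beta>_def
  proof (rule the_equality)
    show "\<exists>h \<in> g <#\<^bsub>G\<^esub> ?H. \<phi> g x = \<phi> h x"
      by (rule bexI[OF refl lcos_self[OF g H]])
    fix y assume "\<exists>h \<in> g <#\<^bsub>G\<^esub> ?H. y = \<phi> h x"
    then obtain h where "h \<in> g <#\<^bsub>G\<^esub> ?H" "y = \<phi> h x" by blast
    then show "y = \<phi> g x" using coset[OF g] by simp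
  qed
  have inj: "g <#\<^bsub>G\<^esub> ?H = h <#\<^bsub>G\<^esub> ?H" if g: "g \<in> carrier G" and h: "h \<in> carrier G"
    and eq: "\<phi> g x = \<phi> h x" for g h
  proof -
    have "\<phi> (inv g \<otimes> h) x = x"
      using orbit_sym_aux[OF g x eq] composition_rule[OF x inv_closed[OF g] h] by simp
    then have "inv g \<otimes> h \<in> ?H" using g h by (simp add: stabilizer_def)
    then have "h \<in> g <#\<^bsub>G\<^esub> ?H" using subgroup.lcos_module_rev[OF H is_group g h] by simp
    then show ?thesis using l_repr_independence[OF _ g H] by simp
  qed
  have "bij_betw \<beta> (lcosets\<^bsub>G\<^esub> ?H) (orbit G \<phi> x)"
    unfolding bij_betw_def
  proof
    show "inj_on \<beta> (lcosets\<^bsub>G\<^esub> ?H)"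
    proof (rule inj_onI)
      fix C D assume CD: "C \<in> lcosets\<^bsub>G\<^esub> ?H" "D \<in> lcosets\<^bsub>G\<^esub> ?H" and eq: "\<beta> C = \<beta> D"
      then obtain g h where gh: "g \<in> carrier G" "C = g <#\<^bsub>G\<^esub> ?H" "h \<in> carrier G" "D = h <#\<^bsub>G\<^esub> ?H"
        unfolding LCOSETS_def by blast
      then show "C = D" using eq inj[OF gh(1,3)] by (simp add: \<beta>)
    qed
    show "\<beta> ` (lcosets\<^bsub>G\<^esub> ?H) = orbit G \<phi> x"
      by (force simp: LCOSETS_def orbit_def \<beta>)
  qed
  then show ?thesis using \<beta> by blast
qed

end

section \<open>The image of a homogeneous hamiltonian space\<close>

theorem mainTheorem6:
  fixes G :: "'g monoid"
    and M :: "('g, 'e::fin_dim_inner) manifold"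
    and N :: "'g set"
    and X :: "('x, 'f::fin_dim_inner) manifold"
    and act :: "'g \<Rightarrow> 'x \<Rightarrow> 'x"
    and \<sigma> :: "'x two_form"
    and \<Phi> :: "'x \<Rightarrow> 'g tvec \<Rightarrow> real"
  assumes "lie_group G M"
    and "N \<lhd> G" and "closedin (mtop M) N"
    and "homogeneous_hamiltonian_space G M X act \<sigma> \<Phi>"
  shows "group_action G (orbit_space G M N) (orbit_space_action G M N) \<and>
    (\<exists>U \<in> orbit_space G M N.
       (N_orbit G M N \<circ> restrict_form G M N \<circ> \<Phi>) ` points X
         = orbit G (orbit_space_action G M N) U \<and>
       (\<exists>\<beta>. bij_betw \<beta> (lcosets\<^bsub>G\<^esub> (stabilizer G (orbit_space_action G M N) U))
                       (orbit G (orbit_space_action G M N) U) \<and>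
            (\<forall>g \<in> carrier G.
               \<beta> (g <#\<^bsub>G\<^esub> stabilizer G (orbit_space_action G M N) U)
                 = orbit_space_action G M N g U)))"
proof -
  interpret lie_group_with_normal G M N
    by (rule lie_group_with_normal.intro[OF assms(1,2)])
  let ?E = "sub_dual G M N" and ?\<psi> = "orbit_space_action G M N"
  interpret coad: group_action G ?E "sub_coad G M N"
    by (rule group_actionI)
       (simp_all add: is_group coad_closed coad_mult coad_one, simp add: coad_def)
  interpret orb: group_action G "orbit_space G M N" ?\<psi>
    using coad.action_on_normal_orbits[OF assms(2)]
    by (simp add: orbit_space_def orbit_space_action_def[abs_def])
  have ham: "hamiltonian_space G M X act \<sigma> \<Phi>"
    and trans: "transitive_action G (points X) act" and ne: "points X \<noteq> {}"
    using assms(4) by (auto simp: homogeneous_hamiltonian_space_def)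
  interpret X: transitive_action G "points X" act by (rule trans)
  have \<Phi>: "\<Phi> x \<in> dual_space M (lie_algebra G M)" if "x \<in> points X" for x
    using ham that by (simp add: hamiltonian_space_def)
  have equiv: "\<Phi> (act g x) = coad G M (lie_algebra G M) g (\<Phi> x)"
    if "g \<in> carrier G" "x \<in> points X" for g x
    using ham that by (simp add: hamiltonian_space_def)
  let ?F = "N_orbit G M N \<circ> restrict_form G M N \<circ> \<Phi>"
  obtain x where x: "x \<in> points X" using ne by blast
  have mem: "?F x \<in> orbit_space G M N"
    using restrict_form_in_dual[OF \<Phi>[OF x]]
    by (auto simp: orbit_space_def orbits_def N_orbit_def)
  have F_act: "?F (act g x) = ?\<psi> g (?F x)" if g: "g \<in> carrier G" for g
    using coad.image_normal_orbit[OF assms(2) g restrict_form_in_dual[OF \<Phi>[OF x]]] mem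
    by (simp add: equiv[OF g x] restrict_form_coad[OF g \<Phi>[OF x]] N_orbit_def orbit_space_action_def)
  have "points X = (\<lambda>g. act g x) ` carrier G"
    using X.unique_orbit[OF x] X.element_image[OF _ x] by blast
  then have "?F ` points X = (\<lambda>g. ?\<psi> g (?F x)) ` carrier G"
    using F_act by (simp add: image_image)
  then have "?F ` points X = orbit G ?\<psi> (?F x)"
    by (auto simp: orbit_def)
  then show ?thesis
    using mem orb.lcosets_stabilizer_bij_orbit[OF mem] orb.group_action_axioms by blast
qed

end
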